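(* There exist absolute constants $C_1,C_2$ such that the following holds. Let $(x_i,y_i)_{i\in[n]}$ be i.i.d. pairs in $\mathbb R^d\times[-1,1]$ whose covariate law is $\mu=\sum_{\ell=1}^k\alpha_\ell\mu_\ell$ with each $\mu_\ell$ satisfying $c$-isoperimetry ($\alpha_\ell\ge0$, $\sum_\ell\alpha_\ell=1$), and with $\sigma^2\equiv\mathbb E^\mu[\mathrm{Var}(y\mid x)]>0$. Let $L,\epsilon>0$ and let $\mathcal F$ be a finite class of $L$-Lipschitz functions $\mathbb R^d\to\mathbb R$. If $d\ge C_1\frac{cL^2\sigma^2}{\epsilon^2}$, then \[ \mathbb P\Big(\exists f\in\mathcal F:\ \tfrac1n\sum_{i=1}^n(y_i-f(x_i))^2\le\sigma^2-\epsilon\Big)\le(4k+1)\exp\Big(-\frac{n\epsilon^2}{8^3k}\Big)+\exp\Big(\log|\mathcal F|-\frac{\epsilon^2nd}{C_2cL^2\sigma^2}\Big). \]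
   Context: A probability measure $\nu$ on $\mathbb R^d$ satisfies $c$-isoperimetry if for every bounded $L$-Lipschitz (w.r.t. the Euclidean norm) $f:\mathbb R^d\to\mathbb R$ and every $t\ge0$, $\mathbb P_{x\sim\nu}[|f(x)-\mathbb E_\nu f|\ge t]\le 2e^{-dt^2/(2cL^2)}$. *)

theory Defs
  imports "HOL-Probability.Probability"
begin

definition Rd :: "nat \<Rightarrow> (nat \<Rightarrow> real) measure" where
  "Rd d = PiM {..<d} (\<lambda>_. borel)"

definition edist :: "nat \<Rightarrow> (nat \<Rightarrow> real) \<Rightarrow> (nat \<Rightarrow> real) \<Rightarrow> real" where
  "edist d x y = sqrt (\<Sum>i<d. (x i - y i)^2)"

definition lipschitz_Rd :: "nat \<Rightarrow> real \<Rightarrow> ((nat \<Rightarrow> real) \<Rightarrow> real) \<Rightarrow> bool" where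
  "lipschitz_Rd d L f \<longleftrightarrow>
     (\<forall>x\<in>space (Rd d). \<forall>y\<in>space (Rd d). \<bar>f x - f y\<bar> \<le> L * edist d x y)"

definition isoperimetric :: "nat \<Rightarrow> real \<Rightarrow> (nat \<Rightarrow> real) measure \<Rightarrow> bool" where
  "isoperimetric d c \<nu> \<longleftrightarrow> prob_space \<nu> \<and> sets \<nu> = sets (Rd d) \<and>
     (\<forall>f L t. lipschitz_Rd d L f \<and> bounded (f ` space (Rd d)) \<and> t \<ge> 0 \<longrightarrow>
        measure \<nu> {x \<in> space \<nu>. \<bar>f x - (\<integral>z. f z \<partial>\<nu>)\<bar> \<ge> t}
          \<le> 2 * exp (- (real d * t^2) / (2 * c * L^2)))"

definition cov_algebra :: "nat \<Rightarrow> ((nat \<Rightarrow> real) \<times> real) measure" where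
  "cov_algebra d = vimage_algebra (space (Rd d \<Otimes>\<^sub>M borel)) fst (Rd d)"

definition exp_cond_var :: "nat \<Rightarrow> ((nat \<Rightarrow> real) \<times> real) measure \<Rightarrow> real" where
  "exp_cond_var d P =
     (\<integral>\<omega>. real_cond_exp P (cov_algebra d)
            (\<lambda>\<omega>'. (snd \<omega>' - real_cond_exp P (cov_algebra d) snd \<omega>')^2) \<omega> \<partial>P)"

end

(* Write y = g(x) + z with g = E[y|x].  If the loss of f is at most sigma^2 - eps then, up to events
   controlled by Hoeffding's inequality, sum_i z_i f(x_i) >= 5 n eps / 16.

   Instead of sampling the mixture component of each x_i, use the densities h_l of alpha_l mu_l with
   respect to mu, which sum to 1.  With m_l the mean of f under mu_l,
     f = sum_l m_l h_l + G,   G = sum_l h_l (f - m_l).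
   The first part does not depend on f except through the bounded coefficients m_l, so a union over
   the 2^k sign patterns bounds its correlation with the noise for all f at once.  Since
   sum_i z_i^2 <= 2 n sigma^2 (eps <= sigma^2 may be assumed), Cauchy-Schwarz then forces
   sum_i G(x_i)^2 >= n eps^2 / (128 sigma^2).  Convexity and isoperimetry bound the exponential
   moment of d G^2 / (4 c L^2) by e^3, and Chernoff's bound makes this event exponentially unlikely;
   the lower bound on d absorbs the factor e^(3n). *)

theory Submission
  imports Defs
begin

section \<open>Lipschitz functions: measurability and truncation\<close>

text \<open>Points of \<open>Rd d\<close> are functions on all of \<open>nat\<close> that are
  \<open>undefined\<close> from \<open>d\<close> on. Precomposing \<open>f\<close> with restriction
  extends it to all functions, where the Lipschitz bound gives continuity in the product topology
  and hence Borel measurability. It then remains to embed \<open>Rd d\<close> measurably into that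
  larger space.\<close>

lemma lipschitz_Rd_measurable:
  assumes "lipschitz_Rd d L f"
  shows "f \<in> borel_measurable (Rd d)"
proof -
  define F where "F z = f (restrict z {..<d})" for z :: "nat \<Rightarrow> real"
  have rs: "restrict z {..<d} \<in> space (Rd d)" for z :: "nat \<Rightarrow> real"
    by (simp add: Rd_def space_PiM)
  have "continuous_on UNIV F"
    unfolding continuous_on_def
  proof
    fix x :: "nat \<Rightarrow> real"
    have "((\<lambda>z. z i) \<longlongrightarrow> x i) (at x)" for i
    proof -
      have "continuous_on UNIV (\<lambda>z :: nat \<Rightarrow> real. z i)" by simp
      then show ?thesis by (simp add: continuous_on_def)
    qed
    then have "((\<lambda>z. L * sqrt (\<Sum>i<d. (z i - x i)^2)) \<longlongrightarrow> L * sqrt (\<Sum>i<d. (x i - x i)^2)) (at x)"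
      by (intro tendsto_intros)
    then have lim: "((\<lambda>z. L * edist d z x) \<longlongrightarrow> 0) (at x)"
      by (simp add: edist_def)
    have "norm (F z - F x) \<le> L * edist d z x" for z
    proof -
      have "norm (F z - F x) \<le> L * edist d (restrict z {..<d}) (restrict x {..<d})"
        using assms rs unfolding lipschitz_Rd_def F_def by simp
      then show ?thesis by (simp add: edist_def)
    qed
    then have "((\<lambda>z. F z - F x) \<longlongrightarrow> 0) (at x)"
      by (intro Lim_null_comparison[OF _ lim]) simp
    then show "(F \<longlongrightarrow> F x) (at x)"
      by (simp add: LIM_zero_iff)
  qed
  then have F: "F \<in> borel_measurable borel"
    by (rule borel_measurable_continuous_onI)
  \<comment> \<open>The embedding is checked coordinate by coordinate; on
    \<open>space (Rd d)\<close> a coordinate with index at least \<open>d\<close> is constant. The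
    product over the countable index set carries exactly the Borel sets of the product
    topology.\<close>
  have "(\<lambda>x. x) \<in> measurable (Rd d) (PiM UNIV (\<lambda>_. borel))"
  proof (rule measurable_PiM_single')
    fix i :: nat
    show "(\<lambda>x. x i) \<in> borel_measurable (Rd d)"
    proof (cases "i < d")
      case True
      then show ?thesis by (simp add: Rd_def)
    next
      case False
      then have "x i = undefined" if "x \<in> space (Rd d)" for x
        using that unfolding Rd_def space_PiM by (metis PiE_arb lessThan_iff)
      then show ?thesis
        using measurable_cong[of "Rd d" "\<lambda>x. x i" "\<lambda>_. undefined" borel] by simp
    qed
  qed simp
  then have "(\<lambda>x. x) \<in> measurable (Rd d) borel"
    unfolding measurable_cong_sets[OF refl sets_PiM_equal_borel] .
  from measurable_compose[OF this F] have "F \<in> borel_measurable (Rd d)" .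
  moreover have "f x = F x" if "x \<in> space (Rd d)" for x
    using that unfolding F_def Rd_def space_PiM by (metis PiE_restrict)
  ultimately show ?thesis
    using measurable_cong[of "Rd d" f F borel] by blast
qed

text \<open>Isoperimetry speaks only of bounded functions, whereas the class may contain unbounded
  ones. Truncation is a contraction, so it yields boundedness at no cost in
  \<open>L\<close>.\<close>

lemma lipschitz_Rd_clamp:
  assumes "lipschitz_Rd d L f"
  shows "lipschitz_Rd d L (\<lambda>x. max (-1) (min 1 (f x)))"
  unfolding lipschitz_Rd_def
proof safe
  fix x y assume "x \<in> space (Rd d)" "y \<in> space (Rd d)"
  then have "\<bar>f x - f y\<bar> \<le> L * edist d x y"
    using assms by (simp add: lipschitz_Rd_def)
  then show "\<bar>max (-1) (min 1 (f x)) - max (-1) (min 1 (f y))\<bar> \<le> L * edist d x y"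
    by linarith
qed

text \<open>Truncation moves a prediction towards every admissible label, so a small loss stays
  small when \<open>f\<close> is truncated.\<close>

lemma clamp_square_le:
  fixes y v :: real
  assumes "y \<in> {-1..1}"
  shows "(y - max (-1) (min 1 v))\<^sup>2 \<le> (y - v)\<^sup>2"
proof -
  have "\<bar>y - max (-1) (min 1 v)\<bar> \<le> \<bar>y - v\<bar>"
    using assms by auto
  then show ?thesis by (simp add: abs_le_square_iff)
qed

section \<open>Tail bounds for i.i.d. sums\<close>

text \<open>Hoeffding's inequality for independent bounded variables, transferred to the coordinates
  of a product measure. The range need only hold almost surely, which suits labels and conditional
  means.\<close>

lemma iid_Hoeffding_ge:
  fixes \<phi> :: "'a \<Rightarrow> real" and n :: nat and a b t :: real
  assumes "prob_space P" and [measurable]: "\<phi> \<in> borel_measurable P"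
    and bnd: "AE x in P. \<phi> x \<in> {a..b}" and "a < b" "t \<ge> 0" "n \<ge> 1"
  shows "measure (PiM {..<n} (\<lambda>_. P))
      {\<omega> \<in> space (PiM {..<n} (\<lambda>_. P)). (\<Sum>i<n. \<phi> (\<omega> i)) \<ge> n * (\<integral>x. \<phi> x \<partial>P) + n * t}
    \<le> exp (- (2 * n * t\<^sup>2 / (b - a)\<^sup>2))"
proof -
  interpret P: prob_space P by fact
  let ?M = "PiM {..<n} (\<lambda>_. P)"
  have ps: "prob_space ?M" by (intro prob_space_PiM P.prob_space_axioms)
  interpret M: prob_space ?M by fact
  have ne: "{..<n} \<noteq> {}" using \<open>n \<ge> 1\<close> by (metis lessThan_iff empty_iff less_le_trans zero_less_one)
  have comp: "distr ?M P (\<lambda>\<omega>. \<omega> i) = P" if "i < n" for i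
    using that by (intro distr_PiM_component P.prob_space_axioms) auto
  \<comment> \<open>Independence is tested on the joint law of the coordinates. That law is the
    product measure itself, because restriction to \<open>{..<n}\<close> is the identity on its
    space.\<close>
  have "M.indep_vars (\<lambda>_. P) (\<lambda>i \<omega>. \<omega> i) {..<n}"
  proof (subst M.indep_vars_iff_distr_eq_PiM'[OF ne])
    have "distr ?M ?M (\<lambda>x. \<lambda>i\<in>{..<n}. x i) = distr ?M ?M (\<lambda>x. x)"
      by (intro distr_cong) (auto simp: space_PiM PiE_restrict)
    also have "\<dots> = PiM {..<n} (\<lambda>i. distr ?M P (\<lambda>\<omega>. \<omega> i))"
      unfolding distr_id by (intro PiM_cong) (auto simp: comp)
    finally show "distr ?M ?M (\<lambda>x. \<lambda>i\<in>{..<n}. x i) = PiM {..<n} (\<lambda>i. distr ?M P (\<lambda>\<omega>. \<omega> i))" .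
  qed auto
  then have ind: "M.indep_vars (\<lambda>_. borel) (\<lambda>i \<omega>. \<phi> (\<omega> i)) {..<n}"
    by (rule M.indep_vars_compose2) auto
  have ex: "M.expectation (\<lambda>\<omega>. \<phi> (\<omega> i)) = P.expectation \<phi>" if "i < n" for i
  proof -
    have "P.expectation \<phi> = integral\<^sup>L (distr ?M P (\<lambda>\<omega>. \<omega> i)) \<phi>"
      by (simp only: comp[OF that])
    also have "\<dots> = M.expectation (\<lambda>\<omega>. \<phi> (\<omega> i))"
      using that by (intro integral_distr) auto
    finally show ?thesis ..
  qed
  interpret H: Hoeffding_ineq ?M "{..<n}" "\<lambda>i \<omega>. \<phi> (\<omega> i)" "\<lambda>_. a" "\<lambda>_. b" "n * P.expectation \<phi>"
  proof unfold_locales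
    show "AE x in ?M. \<phi> (x i) \<in> {a..b}" if "i \<in> {..<n}" for i
      using AE_PiM_component[of "{..<n}" "\<lambda>_. P" i "\<lambda>x. \<phi> x \<in> {a..b}"] P.prob_space_axioms bnd that
      by auto
    show "n * P.expectation \<phi> \<equiv> \<Sum>i<n. M.expectation (\<lambda>\<omega>. \<phi> (\<omega> i))"
      by (simp add: ex)
  qed (use ind in auto)
  have "measure ?M {\<omega> \<in> space ?M. (\<Sum>i<n. \<phi> (\<omega> i)) \<ge> n * (\<integral>x. \<phi> x \<partial>P) + n * t}
     \<le> exp (- 2 * (n * t)\<^sup>2 / (\<Sum>i<n. (b - a)\<^sup>2))"
    using assms by (intro H.Hoeffding_ineq_ge) auto
  also have "- 2 * (n * t)\<^sup>2 / (\<Sum>i<n. (b - a)\<^sup>2) = - (2 * n * t\<^sup>2 / (b - a)\<^sup>2)"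
    using \<open>n \<ge> 1\<close> by (simp add: power_mult_distrib power2_eq_square[of "real n"])
  finally show ?thesis .
qed

text \<open>The indicator of the event is at most \<open>exp (- s)\<close> times the product of the
  \<open>exp (\<psi> (\<omega> i))\<close>, and the integral of this product factorises. Working
  with nonnegative integrals avoids integrability conditions on the exponential.\<close>

lemma iid_Chernoff:
  fixes \<psi> :: "'a \<Rightarrow> real" and n :: nat and b s :: real
  assumes "prob_space P" and [measurable]: "\<psi> \<in> borel_measurable P"
    and mgf: "(\<integral>\<^sup>+x. ennreal (exp (\<psi> x)) \<partial>P) \<le> ennreal (exp b)"
  shows "measure (PiM {..<n} (\<lambda>_. P))
      {\<omega> \<in> space (PiM {..<n} (\<lambda>_. P)). (\<Sum>i<n. \<psi> (\<omega> i)) \<ge> s} \<le> exp (n * b - s)"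
proof -
  interpret P: prob_space P by fact
  let ?M = "PiM {..<n} (\<lambda>_. P)"
  interpret M: prob_space ?M by (intro prob_space_PiM P.prob_space_axioms)
  interpret product_sigma_finite "\<lambda>_::nat. P" by unfold_locales
  let ?A = "{\<omega> \<in> space ?M. (\<Sum>i<n. \<psi> (\<omega> i)) \<ge> s}"
  have [measurable]: "(\<lambda>\<omega>. \<Sum>i<n. \<psi> (\<omega> i)) \<in> borel_measurable ?M" by measurable
  have "emeasure ?M ?A = (\<integral>\<^sup>+\<omega>. indicator ?A \<omega> \<partial>?M)" by simp
  also have "\<dots> \<le> (\<integral>\<^sup>+\<omega>. ennreal (exp (- s)) * (\<Prod>i<n. ennreal (exp (\<psi> (\<omega> i)))) \<partial>?M)"
    by (intro nn_integral_mono)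
      (auto simp: indicator_def prod_ennreal simp flip: exp_sum ennreal_mult exp_add)
  also have "\<dots> = ennreal (exp (- s)) * (\<Prod>i<n. \<integral>\<^sup>+x. ennreal (exp (\<psi> x)) \<partial>P)"
    by (subst nn_integral_cmult) (simp, subst product_nn_integral_prod, auto)
  also have "\<dots> \<le> ennreal (exp (- s)) * (\<Prod>i<n. ennreal (exp b))"
    by (intro mult_left_mono prod_mono_ennreal mgf) auto
  also have "\<dots> = ennreal (exp (n * b - s))"
    by (simp add: exp_diff exp_minus ennreal_power exp_of_nat_mult divide_inverse mult.commute[of "inverse _"]
        flip: ennreal_mult)
  finally show ?thesis
    by (simp add: M.emeasure_eq_measure)
qed

section \<open>Exponential moments of squares\<close>

text \<open>Slice by the integer part \<open>j\<close> of \<open>c * (X x)\<^sup>2\<close>. On a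
  slice the integrand is at most exp(j + 1), while its probability is at most 2 exp(-2j), since the
  tail decays at twice the rate of the integrand. What remains is a geometric series with ratio
  1/e.\<close>

lemma subgaussian_exp_square:
  fixes X :: "'a \<Rightarrow> real"
  assumes "prob_space M" and [measurable]: "X \<in> borel_measurable M" and "0 < c"
    and tail: "\<And>t. t \<ge> 0 \<Longrightarrow> measure M {x \<in> space M. \<bar>X x\<bar> \<ge> t} \<le> 2 * exp (- 2 * c * t\<^sup>2)"
  shows "(\<integral>\<^sup>+x. ennreal (exp (c * (X x)\<^sup>2)) \<partial>M) \<le> ennreal (exp 3)"
proof -
  interpret prob_space M by fact
  define A where "A j = {x \<in> space M. \<bar>X x\<bar> \<ge> sqrt (real j / c)}" for j :: nat
  have [measurable]: "A j \<in> sets M" for j unfolding A_def by measurable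
  have A: "prob (A j) \<le> 2 * exp (- 2 * real j)" for j
    using tail[of "sqrt (real j / c)"] \<open>0 < c\<close> unfolding A_def by simp
  have ptw: "ennreal (exp (c * (X x)\<^sup>2)) \<le> (\<Sum>j. ennreal (exp (real j + 1)) * indicator (A j) x)"
    if "x \<in> space M" for x
  proof -
    \<comment> \<open>The single term of index \<open>j\<close> already dominates the integrand; the
      other terms are nonnegative.\<close>
    define j where "j = nat \<lfloor>c * (X x)\<^sup>2\<rfloor>"
    have j: "real j \<le> c * (X x)\<^sup>2" "c * (X x)\<^sup>2 \<le> real j + 1"
      using \<open>0 < c\<close> by (auto simp: j_def of_nat_floor)
    have "sqrt (real j / c) \<le> sqrt ((X x)\<^sup>2)"
      using j(1) \<open>0 < c\<close> by (intro real_sqrt_le_mono) (simp add: field_simps)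
    then have "x \<in> A j" using that by (simp add: A_def)
    then have "ennreal (exp (c * (X x)\<^sup>2)) \<le> (\<Sum>j\<in>{j}. ennreal (exp (real j + 1)) * indicator (A j) x)"
      using j(2) by (simp add: ennreal_leI)
    also have "\<dots> \<le> (\<Sum>j. ennreal (exp (real j + 1)) * indicator (A j) x)"
      by (intro sum_le_suminf) auto
    finally show ?thesis .
  qed
  have q: "0 \<le> exp (-1::real)" "exp (-1::real) < 1" by simp_all
  have "(\<integral>\<^sup>+x. ennreal (exp (c * (X x)\<^sup>2)) \<partial>M)
      \<le> (\<integral>\<^sup>+x. (\<Sum>j. ennreal (exp (real j + 1)) * indicator (A j) x) \<partial>M)"
    by (intro nn_integral_mono ptw)
  also have "\<dots> = (\<Sum>j. ennreal (exp (real j + 1)) * emeasure M (A j))"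
    by (subst nn_integral_suminf) (auto simp: nn_integral_cmult)
  also have "\<dots> \<le> (\<Sum>j. ennreal (2 * exp 1 * exp (-1) ^ j))"
  proof (intro suminf_le summableI)
    fix j
    have "exp (real j + 1) * prob (A j) \<le> exp (real j + 1) * (2 * exp (- 2 * real j))"
      by (intro mult_left_mono A) simp
    also have "\<dots> = 2 * (exp 1 * exp (real j * (-1)))"
      by (simp flip: exp_add)
    also have "\<dots> = 2 * exp 1 * exp (-1) ^ j"
      by (simp only: exp_of_nat_mult mult.assoc)
    finally show "ennreal (exp (real j + 1)) * emeasure M (A j) \<le> ennreal (2 * exp 1 * exp (-1) ^ j)"
      by (simp add: emeasure_eq_measure ennreal_leI flip: ennreal_mult)
  qed
  also have "\<dots> = ennreal (\<Sum>j. 2 * exp 1 * exp (-1) ^ j)"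
    using q by (intro suminf_ennreal2 summable_mult summable_geometric) auto
  also have "(\<Sum>j. 2 * exp 1 * exp (-1::real) ^ j) = 2 * exp 1 * (1 / (1 - exp (-1)))"
    using q by (subst suminf_mult) (auto simp: suminf_geometric summable_geometric)
  \<comment> \<open>Since e is at least 2, the factor 1/(1 - 1/e) is at most 2 and 4 is at most e^2,
    so the total is at most 4e, hence at most e^3.\<close>
  also have "\<dots> \<le> exp 3"
  proof -
    have "exp (-1::real) \<le> 1/2"
      using exp_ge_add_one_self[of "1::real"] by (simp add: exp_minus field_simps)
    then have "1 / (1 - exp (-1)) \<le> (2::real)"
      by (simp add: divide_simps)
    then have "2 * exp 1 * (1 / (1 - exp (-1))) \<le> 2 * exp 1 * (2::real)"
      by (intro mult_left_mono) auto
    also have "\<dots> \<le> exp 1 * (exp 1 * exp 1)"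
      using mult_mono[of 2 "exp 1::real" 2 "exp 1"] exp_ge_add_one_self[of "1::real"] by simp
    also have "\<dots> = exp (3::real)" by (simp flip: exp_add)
    finally show ?thesis .
  qed
  finally show ?thesis by (simp add: ennreal_leI)
qed

section \<open>Densities of the mixture components and convexity\<close>

text \<open>A null set of the mixture is null for every scaled component, so Radon-Nikodym applies
  to each. The densities sum to one almost everywhere, and changing them on a null set makes this
  hold at every point, so that the \<open>h l x\<close> can serve as convex weights without
  exceptional sets.\<close>

lemma mixture_densities:
  fixes M :: "'a measure" and N :: "nat \<Rightarrow> 'a measure" and \<alpha> :: "nat \<Rightarrow> real" and k :: nat
  assumes "prob_space M" and N: "\<And>l. l < k \<Longrightarrow> prob_space (N l)"
    and sets: "\<And>l. l < k \<Longrightarrow> sets (N l) = sets M"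
    and \<alpha>: "\<And>l. l < k \<Longrightarrow> \<alpha> l \<ge> 0"
    and mix: "\<And>A. A \<in> sets M \<Longrightarrow> measure M A = (\<Sum>l<k. \<alpha> l * measure (N l) A)"
  obtains h :: "nat \<Rightarrow> 'a \<Rightarrow> real"
  where "\<And>l. l < k \<Longrightarrow> h l \<in> borel_measurable M" "\<And>l x. h l x \<ge> 0" "\<And>x. (\<Sum>l<k. h l x) = 1"
    "\<And>l \<phi>. l < k \<Longrightarrow> \<phi> \<in> borel_measurable M \<Longrightarrow>
       (\<integral>\<^sup>+x. ennreal (h l x) * \<phi> x \<partial>M) = ennreal (\<alpha> l) * (\<integral>\<^sup>+x. \<phi> x \<partial>N l)"
proof -
  interpret M: prob_space M by fact
  have emix: "emeasure M A = (\<Sum>l<k. ennreal (\<alpha> l) * emeasure (N l) A)" if "A \<in> sets M" for A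
  proof -
    have "emeasure M A = ennreal (\<Sum>l<k. \<alpha> l * measure (N l) A)"
      using mix[OF that] by (simp add: M.emeasure_eq_measure)
    also have "\<dots> = (\<Sum>l<k. ennreal (\<alpha> l * measure (N l) A))"
      using \<alpha> by (intro sum_ennreal[symmetric]) auto
    also have "\<dots> = (\<Sum>l<k. ennreal (\<alpha> l) * emeasure (N l) A)"
    proof (intro sum.cong refl)
      fix l assume "l \<in> {..<k}"
      then interpret prob_space "N l" using N by simp
      show "ennreal (\<alpha> l * measure (N l) A) = ennreal (\<alpha> l) * emeasure (N l) A"
        using \<alpha> \<open>l \<in> {..<k}\<close> by (simp add: emeasure_eq_measure ennreal_mult)
    qed
    finally show ?thesis .
  qed
  have "\<exists>f \<in> borel_measurable M. density M f = scale_measure (ennreal (\<alpha> l)) (N l)" if "l < k" for l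
  proof (rule M.Radon_Nikodym)
    show "absolutely_continuous M (scale_measure (ennreal (\<alpha> l)) (N l))"
      unfolding absolutely_continuous_def
    proof
      fix A assume A: "A \<in> null_sets M"
      then have "(\<Sum>l<k. ennreal (\<alpha> l) * emeasure (N l) A) = 0"
        using emix[OF null_setsD2[OF A]] null_setsD1[OF A] by simp
      then have "ennreal (\<alpha> l) * emeasure (N l) A = 0"
        using that by simp
      then show "A \<in> null_sets (scale_measure (ennreal (\<alpha> l)) (N l))"
        using A sets[OF that] by (auto simp: null_sets_def)
    qed
  qed (use sets that in simp)
  then obtain f where f: "\<And>l. l < k \<Longrightarrow> f l \<in> borel_measurable M"
    and df: "\<And>l. l < k \<Longrightarrow> density M (f l) = scale_measure (ennreal (\<alpha> l)) (N l)"
    by metis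
  have f_lessThan [measurable]: "l \<in> {..<k} \<Longrightarrow> f l \<in> borel_measurable M" for l
    using f by simp
  \<comment> \<open>Both the sum of the densities and the constant 1 are densities of the mixture
    with respect to itself, and densities are unique almost everywhere.\<close>
  have f1: "AE x in M. (\<Sum>l<k. f l x) = 1"
  proof (subst M.density_unique_iff[symmetric])
    show "density M (\<lambda>x. \<Sum>l<k. f l x) = density M (\<lambda>_. 1)"
    proof (rule measure_eqI)
      fix A assume "A \<in> sets (density M (\<lambda>x. \<Sum>l<k. f l x))"
      then have [measurable]: "A \<in> sets M" by simp
      have "emeasure (density M (\<lambda>x. \<Sum>l<k. f l x)) A = (\<integral>\<^sup>+x. (\<Sum>l<k. f l x * indicator A x) \<partial>M)"
        by (subst emeasure_density) (auto simp: sum_distrib_right)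
      also have "\<dots> = (\<Sum>l<k. \<integral>\<^sup>+x. f l x * indicator A x \<partial>M)"
        by (intro nn_integral_sum) simp
      also have "\<dots> = (\<Sum>l<k. emeasure (density M (f l)) A)"
        by (intro sum.cong refl emeasure_density[symmetric]) auto
      also have "\<dots> = (\<Sum>l<k. ennreal (\<alpha> l) * emeasure (N l) A)"
        by (intro sum.cong refl) (simp add: df)
      also have "\<dots> = emeasure (density M (\<lambda>_. 1)) A"
        by (simp add: emix density_1)
      finally show "emeasure (density M (\<lambda>x. \<Sum>l<k. f l x)) A = emeasure (density M (\<lambda>_. 1)) A" .
    qed simp
  qed simp_all
  have "k \<noteq> 0"
    using mix[of "space M"] M.prob_space by (cases k) auto
  \<comment> \<open>Where the sum is not 1, all the weight goes to component 0, which exists because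
    \<open>k \<noteq> 0\<close>. Elsewhere each density is at most 1, so \<open>enn2real\<close>
    loses nothing.\<close>
  define h where "h l x = (if (\<Sum>l<k. f l x) = 1 then enn2real (f l x) else if l = 0 then 1 else 0)" for l x
  have fh: "f l x = ennreal (h l x)" if "(\<Sum>l<k. f l x) = 1" "l < k" for l x
  proof -
    have "f l x \<le> (\<Sum>l<k. f l x)"
      using that(2) by (intro member_le_sum) auto
    then show ?thesis
      using that by (simp add: h_def ennreal_enn2real order_le_less_trans)
  qed
  show ?thesis
  proof
    show "h l \<in> borel_measurable M" if "l < k" for l
      using f[OF that] unfolding h_def by measurable
    show "h l x \<ge> 0" for l x
      by (simp add: h_def)
    then have h0: "h l x \<ge> 0" for l x .
    show "(\<Sum>l<k. h l x) = 1" for x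
    proof (cases "(\<Sum>l<k. f l x) = 1")
      case True
      have "ennreal (\<Sum>l<k. h l x) = (\<Sum>l<k. ennreal (h l x))"
        using h0 by (intro sum_ennreal[symmetric]) auto
      also have "\<dots> = (\<Sum>l<k. f l x)"
        using fh[OF True] by (intro sum.cong) auto
      finally show ?thesis
        using True by (simp add: ennreal_eq_1)
    next
      case False
      then have "(\<Sum>l<k. h l x) = (\<Sum>l<k. if l = 0 then 1 else 0)"
        by (simp add: h_def)
      then show ?thesis using \<open>k \<noteq> 0\<close> by simp
    qed
    fix l :: nat and \<phi> :: "'a \<Rightarrow> ennreal" assume l: "l < k" and [measurable]: "\<phi> \<in> borel_measurable M"
    have "(\<integral>\<^sup>+x. ennreal (h l x) * \<phi> x \<partial>M) = (\<integral>\<^sup>+x. f l x * \<phi> x \<partial>M)"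
      using f1 by (intro nn_integral_cong_AE) (auto simp: fh l)
    also have "\<dots> = (\<integral>\<^sup>+x. \<phi> x \<partial>density M (f l))"
      using f[OF l] by (intro nn_integral_density[symmetric]) auto
    also have "\<dots> = ennreal (\<alpha> l) * (\<integral>\<^sup>+x. \<phi> x \<partial>N l)"
      unfolding df[OF l]
    proof (rule nn_integral_scale_measure)
      show "\<phi> \<in> borel_measurable (N l)"
        unfolding measurable_cong_sets[OF sets[OF l] refl] by fact
    qed
    finally show "(\<integral>\<^sup>+x. ennreal (h l x) * \<phi> x \<partial>M) = ennreal (\<alpha> l) * (\<integral>\<^sup>+x. \<phi> x \<partial>N l)" .
  qed
qed

text \<open>Jensen's inequality twice, first for the square and then for the exponential.\<close>

lemma exp_square_convex_sum:
  fixes w v :: "nat \<Rightarrow> real" and a :: real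
  assumes "a \<ge> 0" "\<And>l. l < k \<Longrightarrow> w l \<ge> 0" "(\<Sum>l<k. w l) = 1"
  shows "exp (a * (\<Sum>l<k. w l * v l)\<^sup>2) \<le> (\<Sum>l<k. w l * exp (a * (v l)\<^sup>2))"
proof -
  have ne: "{..<k} \<noteq> {}" using assms(3) by (metis sum.empty zero_neq_one)
  have "(\<Sum>l<k. w l * v l)\<^sup>2 \<le> (\<Sum>l<k. w l * (v l)\<^sup>2)"
    using convex_on_sum[OF _ ne convex_power2, of w v] assms by simp
  then have "exp (a * (\<Sum>l<k. w l * v l)\<^sup>2) \<le> exp (a * (\<Sum>l<k. w l * (v l)\<^sup>2))"
    using \<open>a \<ge> 0\<close> by (simp add: mult_left_mono)
  also have "\<dots> \<le> (\<Sum>l<k. w l * exp (a * (v l)\<^sup>2))"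
    using convex_on_sum[OF _ ne convex_on_exp[OF \<open>a \<ge> 0\<close>], of w "\<lambda>l. (v l)\<^sup>2"] assms by simp
  finally show ?thesis .
qed

section \<open>Correlation of the noise with the component densities\<close>

text \<open>A sum of absolute values is attained by one of the \<open>2 ^ k\<close> signed sums.
  Each signed combination of the weights is bounded by 1, so its product with the noise is centred
  with values in [-2, 2]; Hoeffding with range 4 gives the exponent 2nt^2/16. The event mentions no
  function of the class, so one union over signs serves all of them.\<close>

lemma sum_abs_concentration:
  fixes w :: "nat \<Rightarrow> 'a \<Rightarrow> real" and z :: "'a \<Rightarrow> real" and k n :: nat and t :: real
  assumes "prob_space P" and w [measurable]: "\<And>l. l \<in> {..<k} \<Longrightarrow> w l \<in> borel_measurable P"
    and [measurable]: "z \<in> borel_measurable P"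
    and w1: "\<And>x. (\<Sum>l<k. \<bar>w l x\<bar>) \<le> 1" and z2: "AE x in P. \<bar>z x\<bar> \<le> 2"
    and mean: "\<And>l. l < k \<Longrightarrow> (\<integral>x. w l x * z x \<partial>P) = 0"
    and "t \<ge> 0" "n \<ge> 1"
  shows "measure (PiM {..<n} (\<lambda>_. P)) {\<omega> \<in> space (PiM {..<n} (\<lambda>_. P)).
      (\<Sum>l<k. \<bar>\<Sum>i<n. w l (\<omega> i) * z (\<omega> i)\<bar>) \<ge> n * t} \<le> 2 ^ k * exp (- (n * t\<^sup>2 / 8))"
proof -
  interpret P: prob_space P by fact
  let ?M = "PiM {..<n} (\<lambda>_. P)"
  interpret M: prob_space ?M by (intro prob_space_PiM P.prob_space_axioms)
  define S where "S = ({..<k} \<rightarrow>\<^sub>E {-1, 1 :: real})"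
  have S: "finite S" "card S = 2 ^ k"
    by (simp_all add: S_def finite_PiE card_PiE flip: numeral_2_eq_2)
  define \<phi> where "\<phi> s x = (\<Sum>l<k. s l * w l x) * z x" for s x
  have [measurable]: "\<phi> s \<in> borel_measurable P" for s unfolding \<phi>_def by measurable
  define A where "A s = {\<omega> \<in> space ?M. (\<Sum>i<n. \<phi> s (\<omega> i)) \<ge> n * t}" for s
  have [measurable]: "A s \<in> sets ?M" for s unfolding A_def by measurable
  have weight: "\<bar>\<Sum>l<k. s l * w l x\<bar> \<le> 1" if "s \<in> S" for s x
  proof -
    have "\<bar>s l\<bar> = 1" if "l < k" for l
    proof -
      have "s l \<in> {-1, 1}"
        using \<open>s \<in> S\<close> unfolding S_def by (rule PiE_mem) (use that in simp)
      then show ?thesis by auto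
    qed
    then have "\<bar>\<Sum>l<k. s l * w l x\<bar> \<le> (\<Sum>l<k. \<bar>w l x\<bar>)"
      by (intro order_trans[OF sum_abs] sum_mono) (simp add: abs_mult)
    then show ?thesis using w1[of x] by linarith
  qed
  have A: "measure ?M (A s) \<le> exp (- (n * t\<^sup>2 / 8))" if "s \<in> S" for s
  proof -
    have bnd: "AE x in P. \<phi> s x \<in> {-2..2}"
      using z2
    proof eventually_elim
      fix x assume "\<bar>z x\<bar> \<le> 2"
      then have "\<bar>\<phi> s x\<bar> \<le> 1 * 2"
        unfolding \<phi>_def abs_mult using weight[OF that] by (intro mult_mono) auto
      then show "\<phi> s x \<in> {-2..2}" by auto
    qed
    have int: "integrable P (\<lambda>x. w l x * z x)" if "l < k" for l
    proof (rule P.integrable_const_bound[of _ 2])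
      show "AE x in P. norm (w l x * z x) \<le> 2"
        using z2
      proof eventually_elim
        fix x assume "\<bar>z x\<bar> \<le> 2"
        moreover have "\<bar>w l x\<bar> \<le> 1"
          using w1[of x] member_le_sum[of l "{..<k}" "\<lambda>l. \<bar>w l x\<bar>"] that by auto
        ultimately have "\<bar>w l x\<bar> * \<bar>z x\<bar> \<le> 1 * 2"
          by (intro mult_mono) auto
        then show "norm (w l x * z x) \<le> 2" by (simp add: abs_mult)
      qed
      show "(\<lambda>x. w l x * z x) \<in> borel_measurable P"
        using w[of l] that by simp
    qed
    have "(\<integral>x. \<phi> s x \<partial>P) = (\<integral>x. (\<Sum>l<k. s l * (w l x * z x)) \<partial>P)"
      by (simp add: \<phi>_def sum_distrib_right mult.assoc)
    also have "\<dots> = (\<Sum>l<k. s l * (\<integral>x. w l x * z x \<partial>P))"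
      using int by (subst Bochner_Integration.integral_sum) auto
    finally have "(\<integral>x. \<phi> s x \<partial>P) = 0"
      using mean by simp
    then show ?thesis
      using iid_Hoeffding_ge[OF \<open>prob_space P\<close> _ bnd, of t n] assms(7,8)
      by (simp add: A_def)
  qed
  have "{\<omega> \<in> space ?M. (\<Sum>l<k. \<bar>\<Sum>i<n. w l (\<omega> i) * z (\<omega> i)\<bar>) \<ge> n * t} \<subseteq> (\<Union>s\<in>S. A s)"
  proof
    fix \<omega> assume \<omega>: "\<omega> \<in> {\<omega> \<in> space ?M. (\<Sum>l<k. \<bar>\<Sum>i<n. w l (\<omega> i) * z (\<omega> i)\<bar>) \<ge> n * t}"
    define s where "s = (\<lambda>l\<in>{..<k}. if (\<Sum>i<n. w l (\<omega> i) * z (\<omega> i)) \<ge> 0 then 1 else -1 :: real)"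
    have "s \<in> S" by (auto simp: S_def s_def)
    moreover have "(\<Sum>i<n. \<phi> s (\<omega> i)) = (\<Sum>l<k. \<bar>\<Sum>i<n. w l (\<omega> i) * z (\<omega> i)\<bar>)"
    proof -
      have "(\<Sum>i<n. \<phi> s (\<omega> i)) = (\<Sum>l<k. s l * (\<Sum>i<n. w l (\<omega> i) * z (\<omega> i)))"
        unfolding \<phi>_def sum_distrib_right sum_distrib_left mult.assoc by (rule sum.swap)
      also have "\<dots> = (\<Sum>l<k. \<bar>\<Sum>i<n. w l (\<omega> i) * z (\<omega> i)\<bar>)"
        by (intro sum.cong) (auto simp: s_def)
      finally show ?thesis .
    qed
    ultimately show "\<omega> \<in> (\<Union>s\<in>S. A s)" using \<omega> unfolding A_def by force
  qed
  then have "measure ?M {\<omega> \<in> space ?M. (\<Sum>l<k. \<bar>\<Sum>i<n. w l (\<omega> i) * z (\<omega> i)\<bar>) \<ge> n * t}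
      \<le> measure ?M (\<Union>s\<in>S. A s)"
    using S(1) by (intro M.finite_measure_mono) auto
  also have "\<dots> \<le> (\<Sum>s\<in>S. measure ?M (A s))"
    using S(1) by (intro M.finite_measure_subadditive_finite) auto
  also have "\<dots> \<le> (\<Sum>s\<in>S. exp (- (n * t\<^sup>2 / 8)))"
    by (intro sum_mono A)
  finally show ?thesis by (simp add: S(2))
qed

text \<open>The left side is the \<open>k\<close>-th power of 2 exp(-X). The assumption says that
  the part \<open>4 * k * exp (- X)\<close> of the target bound is below 1; it puts this base below
  1, so the power is at most the base.\<close>

lemma sign_count_absorb:
  fixes X :: real and k :: nat
  assumes "k \<ge> 1" "4 * k * exp (- X) < 1"
  shows "2 ^ k * exp (- (k * X)) \<le> 2 * exp (- X)"
proof -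
  have "4 * exp (- X) \<le> 4 * k * exp (- X)" using assms(1) by simp
  then have le: "2 * exp (- X) \<le> 1" using assms(2) by linarith
  have "2 ^ k * exp (- (k * X)) = (2 * exp (- X)) ^ k"
    by (simp add: power_mult_distrib flip: exp_of_nat_mult)
  also have "\<dots> \<le> (2 * exp (- X)) ^ 1"
    using assms(1) le by (intro power_decreasing) auto
  finally show ?thesis by simp
qed

section \<open>Deterministic consequence of a small loss\<close>

text \<open>Expanding the square shows that a small loss requires a large correlation of
  \<open>f\<close> with the noise \<open>z\<close>. The part of \<open>f\<close> spanned by the
  \<open>h l\<close> contributes little, so \<open>G\<close> must carry the correlation, and
  Cauchy-Schwarz turns this into a lower bound on its energy.\<close>

lemma small_loss_forces_fluctuation:
  fixes z g f G :: "nat \<Rightarrow> real" and m :: "nat \<Rightarrow> real" and h :: "nat \<Rightarrow> nat \<Rightarrow> real"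
    and n k :: nat and s e :: real
  assumes loss: "(\<Sum>i<n. (z i + g i - f i)\<^sup>2) \<le> n * (s - e)"
    and z_low: "(\<Sum>i<n. (z i)\<^sup>2) \<ge> n * (s - e / 8)" and z_up: "(\<Sum>i<n. (z i)\<^sup>2) \<le> n * (2 * s)"
    and zg: "(\<Sum>i<n. z i * g i) \<ge> - (n * (e / 8))"
    and f: "\<And>i. i < n \<Longrightarrow> f i = G i + (\<Sum>l<k. m l * h l i)"
    and m: "\<And>l. l < k \<Longrightarrow> \<bar>m l\<bar> \<le> 1"
    and hz: "(\<Sum>l<k. \<bar>\<Sum>i<n. h l i * z i\<bar>) \<le> n * (e / 8)"
    and "s > 0" "e > 0" "n \<ge> 1"
  shows "(\<Sum>i<n. (G i)\<^sup>2) \<ge> n * e\<^sup>2 / (128 * s)"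
proof -
  have "(\<Sum>i<n. (z i + g i - f i)\<^sup>2) =
      (\<Sum>i<n. (z i)\<^sup>2) + 2 * (\<Sum>i<n. z i * g i) - 2 * (\<Sum>i<n. z i * f i) + (\<Sum>i<n. (g i - f i)\<^sup>2)"
    unfolding sum_distrib_left sum.distrib[symmetric] sum_subtractf[symmetric]
    by (intro sum.cong refl) (simp add: power2_eq_square algebra_simps)
  moreover have "(\<Sum>i<n. (g i - f i)\<^sup>2) \<ge> 0" by (intro sum_nonneg) simp
  \<comment> \<open>Of the gap \<open>e\<close>, the lower bound on the noise energy costs e/8 and
    the cross term with \<open>g\<close> costs 2e/8, leaving 5e/8.\<close>
  ultimately have zf: "2 * (\<Sum>i<n. z i * f i) \<ge> 5 * (n * (e / 8))"
    using loss z_low zg by (simp add: algebra_simps)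
  have "(\<Sum>i<n. z i * f i) = (\<Sum>i<n. z i * G i) + (\<Sum>i<n. \<Sum>l<k. m l * (h l i * z i))"
    unfolding sum.distrib[symmetric]
    by (intro sum.cong refl) (simp add: f algebra_simps sum_distrib_left)
  also have "(\<Sum>i<n. \<Sum>l<k. m l * (h l i * z i)) = (\<Sum>l<k. m l * (\<Sum>i<n. h l i * z i))"
    unfolding sum_distrib_left by (rule sum.swap)
  also have "\<dots> \<le> (\<Sum>l<k. \<bar>\<Sum>i<n. h l i * z i\<bar>)"
  proof (intro sum_mono)
    fix l assume "l \<in> {..<k}"
    then have "\<bar>m l\<bar> * \<bar>\<Sum>i<n. h l i * z i\<bar> \<le> 1 * \<bar>\<Sum>i<n. h l i * z i\<bar>"
      using m by (intro mult_right_mono) auto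
    then show "m l * (\<Sum>i<n. h l i * z i) \<le> \<bar>\<Sum>i<n. h l i * z i\<bar>"
      by (simp flip: abs_mult)
  qed
  finally have "(\<Sum>i<n. z i * f i) \<le> (\<Sum>i<n. z i * G i) + n * (e / 8)"
    using hz by linarith
  \<comment> \<open>Halving gives 5e/16; removing 2e/16 for the component part leaves 3e/16, rounded
    down to e/8.\<close>
  then have "n * (e / 8) \<le> (\<Sum>i<n. z i * G i)"
    using zf mult_nonneg_nonneg[of "real n" "e / 8"] \<open>e > 0\<close> by linarith
  then have "(n * (e / 8))\<^sup>2 \<le> (\<Sum>i<n. z i * G i)\<^sup>2"
    using \<open>e > 0\<close> by (intro power_mono) auto
  also have "\<dots> \<le> (\<Sum>i<n. (z i)\<^sup>2) * (\<Sum>i<n. (G i)\<^sup>2)"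
    by (rule Cauchy_Schwarz_ineq_sum)
  also have "\<dots> \<le> n * (2 * s) * (\<Sum>i<n. (G i)\<^sup>2)"
    by (intro mult_right_mono z_up sum_nonneg) simp
  finally have "n * (n * e\<^sup>2) \<le> n * ((128 * s) * (\<Sum>i<n. (G i)\<^sup>2))"
    by (simp add: power2_eq_square algebra_simps)
  then have "n * e\<^sup>2 \<le> (128 * s) * (\<Sum>i<n. (G i)\<^sup>2)"
    using \<open>n \<ge> 1\<close> by (subst (asm) mult_le_cancel_left_pos) auto
  then show ?thesis using \<open>s > 0\<close> by (simp add: field_simps)
qed

section \<open>Isoperimetry, regression noise and mixtures\<close>

text \<open>The isoperimetric exponent d/(2cL^2) is twice d/(4cL^2), which is the factor of two
  between tail and moment that \<open>subgaussian_exp_square\<close> asks for.\<close>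

lemma isoperimetric_exp_square:
  assumes iso: "isoperimetric d c \<nu>" and f: "lipschitz_Rd d L f" "bounded (f ` space (Rd d))"
    and pos: "d > 0" "c > 0" "L > 0"
  shows "(\<integral>\<^sup>+x. ennreal (exp (d / (4 * c * L\<^sup>2) * (f x - (\<integral>u. f u \<partial>\<nu>))\<^sup>2)) \<partial>\<nu>) \<le> ennreal (exp 3)"
proof (rule subgaussian_exp_square)
  show "prob_space \<nu>" using iso by (simp add: isoperimetric_def)
  have "sets \<nu> = sets (Rd d)" using iso by (simp add: isoperimetric_def)
  then have [measurable]: "f \<in> borel_measurable \<nu>"
    using lipschitz_Rd_measurable[OF f(1)] measurable_cong_sets[of \<nu> "Rd d"] by blast
  show "(\<lambda>x. f x - (\<integral>u. f u \<partial>\<nu>)) \<in> borel_measurable \<nu>" by measurable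
  show "0 < d / (4 * c * L\<^sup>2)" using pos by simp
  fix t :: real assume "t \<ge> 0"
  then have "measure \<nu> {x \<in> space \<nu>. \<bar>f x - (\<integral>z. f z \<partial>\<nu>)\<bar> \<ge> t}
      \<le> 2 * exp (- (real d * t\<^sup>2) / (2 * c * L\<^sup>2))"
    using iso f by (simp add: isoperimetric_def)
  also have "- (real d * t\<^sup>2) / (2 * c * L\<^sup>2) = - 2 * (d / (4 * c * L\<^sup>2)) * t\<^sup>2"
    using pos by (simp add: field_simps)
  finally show "measure \<nu> {x \<in> space \<nu>. \<bar>f x - (\<integral>z. f z \<partial>\<nu>)\<bar> \<ge> t}
      \<le> 2 * exp (- 2 * (d / (4 * c * L\<^sup>2)) * t\<^sup>2)" .
qed

text \<open>Here \<open>g\<close> is the regression function, regarded as a function on pairs that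
  is measurable in the covariate alone. The residual \<open>snd \<omega> - g \<omega>\<close> is the
  noise: its second moment is the expected conditional variance by the tower property, and it is
  orthogonal to bounded functions of the covariate.\<close>

lemma
  fixes P :: "((nat \<Rightarrow> real) \<times> real) measure" and d :: nat
  defines "g \<equiv> real_cond_exp P (cov_algebra d) snd"
  assumes "prob_space P" and sets_P [measurable_cong]: "sets P = sets (Rd d \<Otimes>\<^sub>M borel)"
    and y: "AE \<omega> in P. snd \<omega> \<in> {-1..1}"
  shows cond_mean_bounded: "AE \<omega> in P. g \<omega> \<in> {-1..1}"
    and exp_cond_var_eq: "exp_cond_var d P = (\<integral>\<omega>. (snd \<omega> - g \<omega>)\<^sup>2 \<partial>P)"
    and noise_orthogonal_cond_mean: "(\<integral>\<omega>. (snd \<omega> - g \<omega>) * g \<omega> \<partial>P) = 0"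
    and noise_orthogonal: "\<And>h B. h \<in> borel_measurable (Rd d) \<Longrightarrow> (\<And>x. \<bar>h x\<bar> \<le> B) \<Longrightarrow>
      (\<integral>\<omega>. h (fst \<omega>) * (snd \<omega> - g \<omega>) \<partial>P) = 0"
proof -
  interpret prob_space P by fact
  have space_P: "space P = space (Rd d \<Otimes>\<^sub>M borel)"
    using sets_P by (rule sets_eq_imp_space_eq)
  have sub: "subalgebra P (cov_algebra d)"
    unfolding subalgebra_def
  proof
    show "space (cov_algebra d) = space P" by (simp add: cov_algebra_def space_P)
    have fst_P: "fst \<in> measurable P (Rd d)" by measurable
    have fst_sp: "fst \<in> space (Rd d \<Otimes>\<^sub>M borel) \<rightarrow> space (Rd d)"
      by (auto simp: space_pair_measure)
    show "sets (cov_algebra d) \<subseteq> sets P"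
      unfolding cov_algebra_def sets_vimage_algebra2[OF fst_sp]
      using measurable_sets[OF fst_P, unfolded space_P] by blast
  qed
  interpret finite_measure_subalgebra P "cov_algebra d"
    by unfold_locales (fact sub)
  have fst_cov: "fst \<in> measurable (cov_algebra d) (Rd d)"
    unfolding cov_algebra_def by (rule measurable_vimage_algebra1) (auto simp: space_pair_measure)
  have [measurable]: "snd \<in> borel_measurable P" by measurable
  have int_y: "integrable P snd"
  proof (rule integrable_const_bound)
    show "AE \<omega> in P. norm (snd \<omega>) \<le> 1"
      using y by eventually_elim (simp add: abs_le_iff)
  qed simp
  have g_cov: "g \<in> borel_measurable (cov_algebra d)" unfolding g_def by simp
  then have [measurable]: "g \<in> borel_measurable P" by (rule measurable_from_subalg[OF sub])
  have "AE \<omega> in P. g \<omega> \<ge> -1"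
    unfolding g_def using int_y y by (intro real_cond_exp_ge_c) (auto elim!: eventually_mono)
  moreover have "AE \<omega> in P. g \<omega> \<le> 1"
    unfolding g_def using int_y y by (intro real_cond_exp_le_c) (auto elim!: eventually_mono)
  ultimately show g1: "AE \<omega> in P. g \<omega> \<in> {-1..1}"
    by eventually_elim simp
  have z2: "AE \<omega> in P. \<bar>snd \<omega> - g \<omega>\<bar> \<le> 2"
    using y g1 by eventually_elim auto
  have "integrable P (\<lambda>\<omega>. (snd \<omega> - g \<omega>)\<^sup>2)"
  proof (rule integrable_const_bound[of _ 4])
    show "AE \<omega> in P. norm ((snd \<omega> - g \<omega>)\<^sup>2) \<le> 4"
      using z2
    proof eventually_elim
      fix \<omega> assume "\<bar>snd \<omega> - g \<omega>\<bar> \<le> 2"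
      then have "\<bar>snd \<omega> - g \<omega>\<bar>\<^sup>2 \<le> 2\<^sup>2" by (intro power_mono) auto
      then show "norm ((snd \<omega> - g \<omega>)\<^sup>2) \<le> 4" by simp
    qed
  qed measurable
  then show "exp_cond_var d P = (\<integral>\<omega>. (snd \<omega> - g \<omega>)\<^sup>2 \<partial>P)"
    unfolding exp_cond_var_def g_def[symmetric] by (rule real_cond_exp_int)
  \<comment> \<open>The defining property of conditional expectation, tested against a bounded
    \<open>w\<close>. Both orthogonality claims are instances, with \<open>w\<close> equal to
    \<open>g\<close> or to a function of the covariate.\<close>
  have orth: "(\<integral>\<omega>. w \<omega> * (snd \<omega> - g \<omega>) \<partial>P) = 0"
    if w_cov: "w \<in> borel_measurable (cov_algebra d)" and B: "AE \<omega> in P. \<bar>w \<omega>\<bar> \<le> B" for w B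
  proof -
    have [measurable]: "w \<in> borel_measurable P" by (rule measurable_from_subalg[OF sub w_cov])
    have wy: "integrable P (\<lambda>\<omega>. w \<omega> * snd \<omega>)"
    proof (rule integrable_const_bound[of _ "B * 1"])
      show "AE \<omega> in P. norm (w \<omega> * snd \<omega>) \<le> B * 1"
        using B y
      proof eventually_elim
        fix \<omega> assume "\<bar>w \<omega>\<bar> \<le> B" "snd \<omega> \<in> {-1..1}"
        then show "norm (w \<omega> * snd \<omega>) \<le> B * 1"
          unfolding real_norm_def abs_mult by (intro mult_mono) auto
      qed
    qed measurable
    note real_cond_exp_intg[OF wy w_cov \<open>snd \<in> borel_measurable P\<close>, folded g_def]
    then show ?thesis
      using wy by (simp add: right_diff_distrib)
  qed
  show "(\<integral>\<omega>. (snd \<omega> - g \<omega>) * g \<omega> \<partial>P) = 0"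
  proof -
    have "AE \<omega> in P. \<bar>g \<omega>\<bar> \<le> 1"
      using g1 by eventually_elim auto
    from orth[OF g_cov this] show ?thesis by (simp add: mult.commute)
  qed
  show "(\<integral>\<omega>. h (fst \<omega>) * (snd \<omega> - g \<omega>) \<partial>P) = 0"
    if "h \<in> borel_measurable (Rd d)" "\<And>x. \<bar>h x\<bar> \<le> B" for h B
    using orth[OF measurable_compose[OF fst_cov that(1)], of B] that(2) by simp
qed

text \<open>Jensen with the weights \<open>h l x\<close> at each point, after which integrating
  against \<open>h l\<close> under the mixture becomes integrating under component \<open>l\<close>
  with factor \<open>\<alpha> l\<close>. The result is an average of quantities at most
  \<open>b\<close>.\<close>

lemma mixture_exp_square:
  fixes h :: "nat \<Rightarrow> 'a \<Rightarrow> real" and \<alpha> m :: "nat \<Rightarrow> real" and f :: "'a \<Rightarrow> real" and a b :: real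
  assumes [measurable]: "\<And>l. l \<in> {..<k} \<Longrightarrow> h l \<in> borel_measurable M" "f \<in> borel_measurable M"
    and h0: "\<And>l x. h l x \<ge> 0" and h1: "\<And>x. (\<Sum>l<k. h l x) = 1"
    and dens: "\<And>l \<phi>. l < k \<Longrightarrow> \<phi> \<in> borel_measurable M \<Longrightarrow>
       (\<integral>\<^sup>+x. ennreal (h l x) * \<phi> x \<partial>M) = ennreal (\<alpha> l) * (\<integral>\<^sup>+x. \<phi> x \<partial>N l)"
    and \<alpha>: "\<And>l. l < k \<Longrightarrow> \<alpha> l \<ge> 0" "(\<Sum>l<k. \<alpha> l) = 1" and "a \<ge> 0"
    and mgf: "\<And>l. l < k \<Longrightarrow> (\<integral>\<^sup>+x. ennreal (exp (a * (f x - m l)\<^sup>2)) \<partial>N l) \<le> ennreal b"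
  shows "(\<integral>\<^sup>+x. ennreal (exp (a * (\<Sum>l<k. h l x * (f x - m l))\<^sup>2)) \<partial>M) \<le> ennreal b"
proof -
  have "(\<integral>\<^sup>+x. ennreal (exp (a * (\<Sum>l<k. h l x * (f x - m l))\<^sup>2)) \<partial>M)
      \<le> (\<integral>\<^sup>+x. (\<Sum>l<k. ennreal (h l x) * ennreal (exp (a * (f x - m l)\<^sup>2))) \<partial>M)"
  proof (intro nn_integral_mono)
    fix x
    have "ennreal (exp (a * (\<Sum>l<k. h l x * (f x - m l))\<^sup>2))
        \<le> ennreal (\<Sum>l<k. h l x * exp (a * (f x - m l)\<^sup>2))"
      using h0 h1 \<open>a \<ge> 0\<close> by (intro ennreal_leI exp_square_convex_sum) auto
    also have "\<dots> = (\<Sum>l<k. ennreal (h l x * exp (a * (f x - m l)\<^sup>2)))"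
      using h0 by (intro sum_ennreal[symmetric]) auto
    also have "\<dots> = (\<Sum>l<k. ennreal (h l x) * ennreal (exp (a * (f x - m l)\<^sup>2)))"
      using h0 by (simp add: ennreal_mult)
    finally show "ennreal (exp (a * (\<Sum>l<k. h l x * (f x - m l))\<^sup>2)) \<le> \<dots>" .
  qed
  also have "\<dots> = (\<Sum>l<k. \<integral>\<^sup>+x. ennreal (h l x) * ennreal (exp (a * (f x - m l)\<^sup>2)) \<partial>M)"
    by (intro nn_integral_sum) measurable
  also have "\<dots> = (\<Sum>l<k. ennreal (\<alpha> l) * (\<integral>\<^sup>+x. ennreal (exp (a * (f x - m l)\<^sup>2)) \<partial>N l))"
    by (intro sum.cong refl dens) auto
  also have "\<dots> \<le> (\<Sum>l<k. ennreal (\<alpha> l) * ennreal b)"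
    by (intro sum_mono mult_left_mono mgf) auto
  also have "\<dots> = ennreal (\<Sum>l<k. \<alpha> l) * ennreal b"
    using \<alpha>(1) by (subst sum_ennreal[symmetric]) (auto simp: sum_distrib_right)
  finally show ?thesis using \<alpha>(2) by simp
qed

section \<open>Assembly of the probability bound\<close>

lemma law_of_robustness_bound:
  fixes d n k :: nat and c L \<epsilon> s :: real and P :: "((nat \<Rightarrow> real) \<times> real) measure"
    and \<alpha> :: "nat \<Rightarrow> real" and \<mu>s :: "nat \<Rightarrow> (nat \<Rightarrow> real) measure" and F :: "((nat \<Rightarrow> real) \<Rightarrow> real) set"
  defines "s \<equiv> exp_cond_var d P"
  assumes n: "n \<ge> 1" and pos: "c > 0" "L > 0" "\<epsilon> > 0" "s > 0"
    and P: "prob_space P" and sets_P [measurable_cong]: "sets P = sets (Rd d \<Otimes>\<^sub>M borel)"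
    and y: "AE \<omega> in P. snd \<omega> \<in> {-1..1}"
    and \<alpha>: "\<And>l. l < k \<Longrightarrow> \<alpha> l \<ge> 0" "(\<Sum>l<k. \<alpha> l) = 1"
    and iso: "\<And>l. l < k \<Longrightarrow> isoperimetric d c (\<mu>s l)"
    and mix: "\<And>A. A \<in> sets (Rd d) \<Longrightarrow> measure (distr P (Rd d) fst) A = (\<Sum>l<k. \<alpha> l * measure (\<mu>s l) A)"
    and F: "finite F" "\<And>f. f \<in> F \<Longrightarrow> lipschitz_Rd d L f"
    and dim: "real d \<ge> 3072 * c * L\<^sup>2 * s / \<epsilon>\<^sup>2"
  shows "measure (PiM {..<n} (\<lambda>_. P))
        {\<omega> \<in> space (PiM {..<n} (\<lambda>_. P)).
           \<exists>f\<in>F. (1 / real n) * (\<Sum>i<n. (snd (\<omega> i) - f (fst (\<omega> i)))^2) \<le> s - \<epsilon>}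
      \<le> (4 * real k + 1) * exp (- (real n * \<epsilon>^2) / (8^3 * real k))
        + exp (ln (real (card F)) - \<epsilon>^2 * real n * real d / (1024 * c * L^2 * s))"
    (is "measure ?M ?E \<le> ?rhs")
proof -
  interpret P: prob_space P by fact
  interpret M: prob_space ?M by (intro prob_space_PiM P)
  have "k \<noteq> 0" using \<alpha>(2) by (cases k) auto
  have d: "d > 0"
  proof -
    have "0 < 3072 * c * L\<^sup>2 * s / \<epsilon>\<^sup>2" using pos by simp
    then show ?thesis using dim by linarith
  qed
  \<comment> \<open>\<open>X\<close> is the exponent of the first term, with 512 = 8^3.
    \<open>R\<close> is the dimensionless ratio governing the second; the assumption on
    \<open>d\<close> says exactly that \<open>R\<close> is at least 3072.\<close>
  define X where "X = n * \<epsilon>\<^sup>2 / (512 * k)"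
  define R where "R = \<epsilon>\<^sup>2 * d / (c * L\<^sup>2 * s)"
  have R: "R \<ge> 3072"
    using dim pos by (simp add: R_def field_simps)
  have rhs: "?rhs = (4 * real k + 1) * exp (- X) + exp (ln (real (card F)) - n * R / 1024)"
    by (simp add: X_def R_def field_simps)
  have kX: "k * X = n * \<epsilon>\<^sup>2 / 512" using \<open>k \<noteq> 0\<close> by (simp add: X_def)
  have X0: "X \<ge> 0" by (simp add: X_def)
  have "X \<le> k * X" using \<open>k \<noteq> 0\<close> X0 by (simp add: mult_le_cancel_right1)
  then have expX: "exp (- (n * \<epsilon>\<^sup>2 / 512)) \<le> exp (- X)" using kX by simp
  \<comment> \<open>In the first two cases the event is empty, since losses are nonnegative, and in
    the third the bound exceeds 1. The last case may therefore use
    \<open>\<epsilon> \<le> s\<close>, a nonempty class and the hypothesis of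
    \<open>sign_count_absorb\<close>.\<close>
  consider "s < \<epsilon>" | "F = {}" | "4 * k * exp (- X) \<ge> 1" | "\<epsilon> \<le> s" "F \<noteq> {}" "4 * k * exp (- X) < 1"
    by linarith
  then show ?thesis
  proof cases
    case 1
    have "(1 / real n) * (\<Sum>i<n. (snd (\<omega> i) - f (fst (\<omega> i)))^2) \<ge> 0" for \<omega> f
      by (intro mult_nonneg_nonneg sum_nonneg) auto
    with 1 have "?E = {}" by (fastforce dest: order_trans)
    then show ?thesis unfolding rhs by (metis (lifting) measure_empty add_nonneg_nonneg
          mult_nonneg_nonneg exp_ge_zero of_nat_0_le_iff zero_le_numeral zero_le_one)
  next
    case 2
    then show ?thesis by simp
  next
    case 3
    have "measure ?M ?E \<le> 1" by simp
    also have "1 \<le> (4 * real k + 1) * exp (- X)" unfolding distrib_right using 3 exp_ge_zero[of "- X"] by linarith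
    finally show ?thesis unfolding rhs by (simp add: add_increasing2)
  next
    case 4
    have fst_P [measurable]: "fst \<in> measurable P (Rd d)" by measurable
    define \<mu> where "\<mu> = distr P (Rd d) fst"
    have [simp, measurable_cong]: "sets \<mu> = sets (Rd d)" by (simp add: \<mu>_def)
    have "prob_space \<mu>" unfolding \<mu>_def by (rule P.prob_space_distr) fact
    obtain h where h_meas: "\<And>l. l < k \<Longrightarrow> h l \<in> borel_measurable \<mu>"
      and h0: "\<And>l x. h l x \<ge> 0" and h1: "\<And>x. (\<Sum>l<k. h l x) = 1"
      and dens: "\<And>l \<phi>. l < k \<Longrightarrow> \<phi> \<in> borel_measurable \<mu> \<Longrightarrow>
       (\<integral>\<^sup>+x. ennreal (h l x) * \<phi> x \<partial>\<mu>) = ennreal (\<alpha> l) * (\<integral>\<^sup>+x. \<phi> x \<partial>\<mu>s l)"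
    proof (rule mixture_densities[OF \<open>prob_space \<mu>\<close>])
      show "prob_space (\<mu>s l)" "sets (\<mu>s l) = sets \<mu>" if "l < k" for l
        using iso[OF that] by (auto simp: isoperimetric_def)
      show "measure \<mu> A = (\<Sum>l<k. \<alpha> l * measure (\<mu>s l) A)" if "A \<in> sets \<mu>" for A
        using mix that by (simp add: \<mu>_def)
    qed (use \<alpha> in auto)
    have h_Rd [measurable]: "h l \<in> borel_measurable (Rd d)" if "l \<in> {..<k}" for l
      using h_meas[of l] that by (simp add: \<mu>_def)
    have h_le_1: "h l x \<le> 1" if "l < k" for l x
      using member_le_sum[of l "{..<k}" "\<lambda>l. h l x"] h0 h1[of x] that by simp
    define g where "g = real_cond_exp P (cov_algebra d) snd"
    define z where "z \<omega> = snd \<omega> - g \<omega>" for \<omega>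
    note noise = cond_mean_bounded[OF P sets_P y, folded g_def]
      exp_cond_var_eq[OF P sets_P y, folded g_def s_def, folded z_def]
      noise_orthogonal_cond_mean[OF P sets_P y, folded g_def, folded z_def]
      noise_orthogonal[OF P sets_P y, folded g_def, folded z_def]
    have [measurable]: "g \<in> borel_measurable P" by (simp add: g_def)
    have [measurable]: "z \<in> borel_measurable P" unfolding z_def by measurable
    have z2: "AE \<omega> in P. \<bar>z \<omega>\<bar> \<le> 2"
      using y noise(1) by eventually_elim (auto simp: z_def)
    have z4: "AE \<omega> in P. (z \<omega>)\<^sup>2 \<in> {0..4}"
      using z2
    proof eventually_elim
      fix \<omega> assume "\<bar>z \<omega>\<bar> \<le> 2"
      then have "\<bar>z \<omega>\<bar>\<^sup>2 \<le> 2\<^sup>2" by (intro power_mono) auto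
      then show "(z \<omega>)\<^sup>2 \<in> {0..4}" by simp
    qed
    have zg2: "AE \<omega> in P. - (z \<omega> * g \<omega>) \<in> {-2..2}"
      using z2 noise(1)
    proof eventually_elim
      fix \<omega> assume "\<bar>z \<omega>\<bar> \<le> 2" "g \<omega> \<in> {-1..1}"
      then have "\<bar>z \<omega>\<bar> * \<bar>g \<omega>\<bar> \<le> 2 * 1" by (intro mult_mono) auto
      then show "- (z \<omega> * g \<omega>) \<in> {-2..2}" by (auto simp: abs_le_iff simp flip: abs_mult)
    qed
    define cl where "cl f x = max (-1) (min 1 (f x :: real))" for f and x :: "nat \<Rightarrow> real"
    have cl_lip: "lipschitz_Rd d L (cl f)" if "f \<in> F" for f
      unfolding cl_def using F(2)[OF that] by (rule lipschitz_Rd_clamp)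
    have cl_1: "\<bar>cl f x\<bar> \<le> 1" for f x by (simp add: cl_def)
    have cl_meas: "cl f \<in> borel_measurable (Rd d)" if "f \<in> F" for f
      using cl_lip[OF that] by (rule lipschitz_Rd_measurable)
    define m where "m f l = (\<integral>x. cl f x \<partial>\<mu>s l)" for f l
    have m_1: "\<bar>m f l\<bar> \<le> 1" if "f \<in> F" "l < k" for f l
    proof -
      interpret N: prob_space "\<mu>s l" using iso[OF that(2)] by (simp add: isoperimetric_def)
      have "sets (\<mu>s l) = sets (Rd d)" using iso[OF that(2)] by (simp add: isoperimetric_def)
      then have meas: "cl f \<in> borel_measurable (\<mu>s l)"
        using cl_meas[OF that(1)] measurable_cong_sets by blast
      have "norm (m f l) \<le> (\<integral>x. norm (cl f x) \<partial>\<mu>s l)"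
        unfolding m_def by (rule integral_norm_bound)
      also have "\<dots> \<le> 1"
        using meas cl_1[of f] by (intro N.integral_le_const N.integrable_const_bound[of _ 1]) auto
      finally show ?thesis by simp
    qed
    \<comment> \<open>The fluctuation of the truncated function about its component means, averaged
      with the local weights.\<close>
    define G where "G f x = (\<Sum>l<k. h l x * (cl f x - m f l))" for f x
    have G_meas: "G f \<in> borel_measurable (Rd d)" if "f \<in> F" for f
      unfolding G_def using cl_meas[OF that] by measurable
    define a where "a = d / (4 * c * L\<^sup>2)"
    have a0: "a > 0" using d pos by (simp add: a_def)
    have G_mgf: "(\<integral>\<^sup>+\<omega>. ennreal (exp (a * (G f (fst \<omega>))\<^sup>2)) \<partial>P) \<le> ennreal (exp 3)" if "f \<in> F" for f
    proof -
      note [measurable] = G_meas[OF that] cl_meas[OF that]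
      have "(\<integral>\<^sup>+\<omega>. ennreal (exp (a * (G f (fst \<omega>))\<^sup>2)) \<partial>P) = (\<integral>\<^sup>+x. ennreal (exp (a * (G f x)\<^sup>2)) \<partial>\<mu>)"
        unfolding \<mu>_def by (rule nn_integral_distr[symmetric]) measurable
      also have "\<dots> \<le> ennreal (exp 3)"
        unfolding G_def
      proof (rule mixture_exp_square[OF _ _ h0 h1 dens])
        show "(\<integral>\<^sup>+x. ennreal (exp (a * (cl f x - m f l)\<^sup>2)) \<partial>\<mu>s l) \<le> ennreal (exp 3)" if "l < k" for l
          unfolding a_def m_def
        proof (rule isoperimetric_exp_square)
          show "bounded (cl f ` space (Rd d))"
            using cl_1 by (intro boundedI[of _ 1]) auto
        qed (use iso that cl_lip \<open>f \<in> F\<close> d pos in auto)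
      qed (use \<alpha> a0 in \<open>auto simp: \<mu>_def\<close>)
      finally show ?thesis .
    qed
    \<comment> \<open>The bad events: noise energy too low, noise anticorrelated with
      \<open>g\<close>, noise energy too high, noise correlated with the densities, and large
      fluctuation of one \<open>f\<close>. Sums bounded from below appear negated because
      \<open>iid_Hoeffding_ge\<close> is an upper-tail bound. For the first two the range is 4 and
      the deviation \<epsilon>/8, hence the exponent n\<epsilon>^2/512.\<close>
    define B1 where "B1 = {\<omega> \<in> space ?M. (\<Sum>i<n. - (z (\<omega> i))\<^sup>2) \<ge> n * (- s) + n * (\<epsilon> / 8)}"
    define B2 where "B2 = {\<omega> \<in> space ?M. (\<Sum>i<n. - (z (\<omega> i) * g (\<omega> i))) \<ge> n * 0 + n * (\<epsilon> / 8)}"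
    define B3 where "B3 = {\<omega> \<in> space ?M. (\<Sum>i<n. (z (\<omega> i))\<^sup>2) \<ge> n * s + n * \<epsilon>}"
    define B4 where "B4 = {\<omega> \<in> space ?M. (\<Sum>l<k. \<bar>\<Sum>i<n. h l (fst (\<omega> i)) * z (\<omega> i)\<bar>) \<ge> n * (\<epsilon> / 8)}"
    define B5 where "B5 f = {\<omega> \<in> space ?M. (\<Sum>i<n. a * (G f (fst (\<omega> i)))\<^sup>2) \<ge> n * (R / 512)}" for f
    have sets14 [measurable]: "B1 \<in> sets ?M" "B2 \<in> sets ?M" "B3 \<in> sets ?M" "B4 \<in> sets ?M"
      unfolding B1_def B2_def B3_def B4_def by measurable
    have sets5 [measurable]: "B5 f \<in> sets ?M" if "f \<in> F" for f
      unfolding B5_def using G_meas[OF that] by measurable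
    have B1: "measure ?M B1 \<le> exp (- X)"
    proof -
      have *: "AE \<omega> in P. - (z \<omega>)\<^sup>2 \<in> {-4..0}" using z4 by eventually_elim auto
      have "measure ?M B1 \<le> exp (- (n * \<epsilon>\<^sup>2 / 512))"
        using iid_Hoeffding_ge[OF P _ *, of "\<epsilon> / 8" n] n pos noise(2)
        by (simp add: B1_def power_divide)
      then show ?thesis using expX by linarith
    qed
    have B2: "measure ?M B2 \<le> exp (- X)"
    proof -
      have "measure ?M B2 \<le> exp (- (n * \<epsilon>\<^sup>2 / 512))"
        using iid_Hoeffding_ge[OF P _ zg2, of "\<epsilon> / 8" n] n pos noise(3)
        by (simp add: B2_def power_divide)
      then show ?thesis using expX by linarith
    qed
    have B3: "measure ?M B3 \<le> exp (- X)"
    proof -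
      have "measure ?M B3 \<le> exp (- (n * \<epsilon>\<^sup>2 / 8))"
        using iid_Hoeffding_ge[OF P _ z4, of "\<epsilon>" n] n pos noise(2)
        by (simp add: B3_def)
      also have "\<dots> \<le> exp (- (n * \<epsilon>\<^sup>2 / 512))" by simp
      finally show ?thesis using expX by linarith
    qed
    have B4: "measure ?M B4 \<le> 2 * exp (- X)"
    proof -
      have "measure ?M B4 \<le> 2 ^ k * exp (- (n * (\<epsilon> / 8)\<^sup>2 / 8))"
        unfolding B4_def
      proof (rule sum_abs_concentration[OF P])
        show "(\<Sum>l<k. \<bar>h l (fst x)\<bar>) \<le> 1" for x :: "(nat \<Rightarrow> real) \<times> real"
          using h0 h1 by simp
        show "(\<integral>x. h l (fst x) * z x \<partial>P) = 0" if "l < k" for l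
          using h_Rd[of l] h0[of l] h_le_1[OF that] that by (intro noise(4)[of _ 1]) auto
      qed (use z2 n pos in auto)
      also have "\<dots> = 2 ^ k * exp (- (k * X))"
        by (simp add: kX power_divide)
      also have "\<dots> \<le> 2 * exp (- X)"
        using \<open>k \<noteq> 0\<close> 4(3) by (intro sign_count_absorb) auto
      finally show ?thesis .
    qed
    have B5: "measure ?M (B5 f) \<le> exp (- (n * R / 1024))" if "f \<in> F" for f
    proof -
      have "measure ?M (B5 f) \<le> exp (real n * 3 - n * (R / 512))"
        unfolding B5_def
        by (rule iid_Chernoff[OF P _ G_mgf[OF that]]) (use G_meas[OF that] in measurable)
      \<comment> \<open>Since 3072 = 3 * 1024, half of the exponent nR/512 pays for the factor
        e^(3n) from the exponential moments and the other half survives.\<close>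
      also have "real n * 3 \<le> n * (R / 1024)"
        using R by (intro mult_left_mono) auto
      then have "exp (real n * 3 - n * (R / 512)) \<le> exp (- (n * R / 1024))" by simp
      finally show ?thesis .
    qed
    \<comment> \<open>Labels lie in [-1, 1] only almost surely, and truncation relies on it, so the
      event is covered by the bad events up to a null set.\<close>
    have "AE \<omega> in ?M. \<forall>i\<in>{..<n}. snd (\<omega> i) \<in> {-1..1}"
      using y by (intro AE_finite_allI AE_PiM_component P) auto
    then have "AE \<omega> in ?M. \<omega> \<in> ?E \<longrightarrow> \<omega> \<in> B1 \<union> B2 \<union> B3 \<union> B4 \<union> (\<Union>f\<in>F. B5 f)"
    proof (eventually_elim, intro impI)
      fix \<omega> assume y: "\<forall>i\<in>{..<n}. snd (\<omega> i) \<in> {-1..1}" and E: "\<omega> \<in> ?E"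
      then obtain f where "f \<in> F" and \<omega>: "\<omega> \<in> space ?M"
        and loss: "(1 / real n) * (\<Sum>i<n. (snd (\<omega> i) - f (fst (\<omega> i)))\<^sup>2) \<le> s - \<epsilon>" by blast
      show "\<omega> \<in> B1 \<union> B2 \<union> B3 \<union> B4 \<union> (\<Union>f\<in>F. B5 f)"
      proof (rule ccontr)
        assume out: "\<not> ?thesis"
        have "(\<Sum>i<n. (G f (fst (\<omega> i)))\<^sup>2) \<ge> n * \<epsilon>\<^sup>2 / (128 * s)"
        proof (rule small_loss_forces_fluctuation)
          have "(\<Sum>i<n. (z (\<omega> i) + g (\<omega> i) - cl f (fst (\<omega> i)))\<^sup>2)
              \<le> (\<Sum>i<n. (snd (\<omega> i) - f (fst (\<omega> i)))\<^sup>2)"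
            unfolding cl_def z_def using y by (intro sum_mono) (simp add: clamp_square_le)
          also have "\<dots> \<le> n * (s - \<epsilon>)"
            using loss n by (simp add: field_simps)
          finally show "(\<Sum>i<n. (z (\<omega> i) + g (\<omega> i) - cl f (fst (\<omega> i)))\<^sup>2) \<le> n * (s - \<epsilon>)" .
          show "n * (s - \<epsilon> / 8) \<le> (\<Sum>i<n. (z (\<omega> i))\<^sup>2)"
            using out \<omega> by (auto simp: B1_def sum_negf algebra_simps)
          show "(\<Sum>i<n. (z (\<omega> i))\<^sup>2) \<le> n * (2 * s)"
          proof -
            have "(\<Sum>i<n. (z (\<omega> i))\<^sup>2) \<le> n * s + n * \<epsilon>"
              using out \<omega> by (auto simp: B3_def)
            also have "n * s + n * \<epsilon> \<le> n * s + n * s"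
              using 4(1) by (intro add_left_mono mult_left_mono) auto
            finally show ?thesis by (simp add: algebra_simps)
          qed
          show "- (n * (\<epsilon> / 8)) \<le> (\<Sum>i<n. z (\<omega> i) * g (\<omega> i))"
            using out \<omega> by (auto simp: B2_def sum_negf)
          show "(\<Sum>l<k. \<bar>\<Sum>i<n. h l (fst (\<omega> i)) * z (\<omega> i)\<bar>) \<le> n * (\<epsilon> / 8)"
            using out \<omega> by (auto simp: B4_def)
          \<comment> \<open>An exact identity, because the weights sum to one at every
            point.\<close>
          show "cl f (fst (\<omega> i)) = G f (fst (\<omega> i)) + (\<Sum>l<k. m f l * h l (fst (\<omega> i)))" for i
          proof -
            have "G f (fst (\<omega> i)) + (\<Sum>l<k. m f l * h l (fst (\<omega> i)))
                = (\<Sum>l<k. h l (fst (\<omega> i)) * cl f (fst (\<omega> i)))"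
              unfolding G_def sum.distrib[symmetric] by (intro sum.cong) (auto simp: algebra_simps)
            then show ?thesis by (simp add: h1 flip: sum_distrib_right)
          qed
        qed (use m_1 \<open>f \<in> F\<close> pos n in auto)
        then have "a * (n * \<epsilon>\<^sup>2 / (128 * s)) \<le> a * (\<Sum>i<n. (G f (fst (\<omega> i)))\<^sup>2)"
          using a0 by (intro mult_left_mono) auto
        \<comment> \<open>The constants multiply as 4 * 128 = 512, which is where the threshold of
          \<open>B5\<close> comes from.\<close>
        moreover have "a * (n * \<epsilon>\<^sup>2 / (128 * s)) = n * (R / 512)"
          using pos by (simp add: a_def R_def field_simps)
        ultimately have "\<omega> \<in> B5 f"
          using \<omega> unfolding B5_def sum_distrib_left by (metis (mono_tags, lifting) mem_Collect_eq)
        then show False using out \<open>f \<in> F\<close> by auto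
      qed
    qed
    moreover have B5_Un [measurable]: "(\<Union>f\<in>F. B5 f) \<in> sets ?M"
      using F(1) sets5 by (intro sets.finite_UN) auto
    ultimately have "measure ?M ?E \<le> measure ?M (B1 \<union> B2 \<union> B3 \<union> B4 \<union> (\<Union>f\<in>F. B5 f))"
      by (intro M.finite_measure_mono_AE sets.Un sets14 B5_Un)
    also have "\<dots> \<le> measure ?M B1 + measure ?M B2 + measure ?M B3 + measure ?M B4 + measure ?M (\<Union>f\<in>F. B5 f)"
    proof -
      have "measure ?M (B1 \<union> B2) \<le> measure ?M B1 + measure ?M B2"
        "measure ?M (B1 \<union> B2 \<union> B3) \<le> measure ?M (B1 \<union> B2) + measure ?M B3"
        "measure ?M (B1 \<union> B2 \<union> B3 \<union> B4) \<le> measure ?M (B1 \<union> B2 \<union> B3) + measure ?M B4"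
        "measure ?M (B1 \<union> B2 \<union> B3 \<union> B4 \<union> (\<Union>f\<in>F. B5 f))
          \<le> measure ?M (B1 \<union> B2 \<union> B3 \<union> B4) + measure ?M (\<Union>f\<in>F. B5 f)"
        by (intro measure_Un_le sets.Un sets14 B5_Un)+
      then show ?thesis by linarith
    qed
    also have "measure ?M (\<Union>f\<in>F. B5 f) \<le> (\<Sum>f\<in>F. measure ?M (B5 f))"
      using F(1) sets5 by (intro M.finite_measure_subadditive_finite) auto
    also have "\<dots> \<le> (\<Sum>f\<in>F. exp (- (n * R / 1024)))"
      by (intro sum_mono B5)
    also have "\<dots> = exp (ln (real (card F)) - n * R / 1024)"
      using 4(2) F(1) unfolding diff_conv_add_uminus exp_add by (simp add: card_gt_0_iff)
    also have "measure ?M B1 + measure ?M B2 + measure ?M B3 + measure ?M B4 \<le> 5 * exp (- X)"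
      using B1 B2 B3 B4 by linarith
    \<comment> \<open>The three Hoeffding events and twice that for \<open>B4\<close> make 5, which
      is at most 4k + 1 as \<open>k\<close> is at least 1.\<close>
    also have "5 * exp (- X) \<le> (4 * real k + 1) * exp (- X)"
      using \<open>k \<noteq> 0\<close> by (intro mult_right_mono) auto
    finally show ?thesis unfolding rhs by simp
  qed
qed

theorem mainTheorem5:
  shows "\<exists>C1 C2 :: real. C1 > 0 \<and> C2 > 0 \<and>
    (\<forall>(d::nat) (n::nat) (k::nat) (c::real) (L::real) (\<epsilon>::real)
       (P :: ((nat \<Rightarrow> real) \<times> real) measure)
       (\<alpha> :: nat \<Rightarrow> real) (\<mu>s :: nat \<Rightarrow> (nat \<Rightarrow> real) measure)
       (F :: ((nat \<Rightarrow> real) \<Rightarrow> real) set).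
      n \<ge> 1 \<and> c > 0 \<and> L > 0 \<and> \<epsilon> > 0 \<and>
      prob_space P \<and> sets P = sets (Rd d \<Otimes>\<^sub>M borel) \<and>
      (AE \<omega> in P. snd \<omega> \<in> {-1..1}) \<and>
      (\<forall>l<k. \<alpha> l \<ge> 0) \<and> (\<Sum>l<k. \<alpha> l) = 1 \<and>
      (\<forall>l<k. isoperimetric d c (\<mu>s l)) \<and>
      (\<forall>A\<in>sets (Rd d). measure (distr P (Rd d) fst) A = (\<Sum>l<k. \<alpha> l * measure (\<mu>s l) A)) \<and>
      exp_cond_var d P > 0 \<and>
      finite F \<and> (\<forall>f\<in>F. lipschitz_Rd d L f) \<and>
      real d \<ge> C1 * c * L^2 * exp_cond_var d P / \<epsilon>^2
      \<longrightarrow>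
      measure (PiM {..<n} (\<lambda>_. P))
        {\<omega> \<in> space (PiM {..<n} (\<lambda>_. P)).
           \<exists>f\<in>F. (1 / real n) * (\<Sum>i<n. (snd (\<omega> i) - f (fst (\<omega> i)))^2)
                     \<le> exp_cond_var d P - \<epsilon>}
      \<le> (4 * real k + 1) * exp (- (real n * \<epsilon>^2) / (8^3 * real k))
        + exp (ln (real (card F)) - \<epsilon>^2 * real n * real d / (C2 * c * L^2 * exp_cond_var d P)))"
proof (rule exI[of _ 3072], rule exI[of _ 1024], intro conjI allI impI, goal_cases)
  case (3 d n k c L \<epsilon> P \<alpha> \<mu>s F)
  show ?case
    by (rule law_of_robustness_bound[where \<alpha> = \<alpha> and \<mu>s = \<mu>s and c = c]) (use 3 in simp_all)
qed simp_all

end
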